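(* There exists a magic knight's tour in the $4$-dimensional $4 \times 4 \times 4 \times 4$ hypercube; that is, there is a knight's tour in which the sum of the numbers in every line is $514$.
   Context: The $4\times 4\times 4\times 4$ hypercube is the lattice of $256$ cells $\{1,2,3,4\}^4$. A knight's move goes from one cell to another cell such that their coordinates differ by exactly $2$ in absolute value in one coordinate, by exactly $1$ in absolute value in another coordinate, and agree in all remaining coordinates. A knight's tour is a sequence of knight's moves that visits every cell exactly once; the cells are numbered $1,2,\dots,256$ in the order in which they are visited. A line (row, column, pillar or post) is a set of $4$ cells obtained by fixing three of the coordinates and letting the remaining coordinate run over $1,\dots,4$. A knight's tour (open or closed) is magic if the sum of the numbers is the same for every line (space diagonals are not required to have this sum). *)

theory Defs
  imports Main
begin

definition cells :: "int list set" where
  "cells = {c. length c = 4 \<and> set c \<subseteq> {1..4}}"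

definition knight_move :: "int list \<Rightarrow> int list \<Rightarrow> bool" where
  "knight_move c d \<longleftrightarrow> c \<in> cells \<and> d \<in> cells \<and>
     (\<exists>i<4. \<exists>j<4. i \<noteq> j \<and> \<bar>c ! i - d ! i\<bar> = 2 \<and> \<bar>c ! j - d ! j\<bar> = 1 \<and>
        (\<forall>k<4. k \<noteq> i \<and> k \<noteq> j \<longrightarrow> c ! k = d ! k))"

text \<open>In a tour \<open>t\<close>, the cell visited at step \<open>n\<close> is \<open>t n\<close>, for \<open>n = 1, \<dots>, 256\<close>; the values
  of \<open>t\<close> at other arguments are irrelevant. A tour need not be closed.\<close>

definition knights_tour :: "(nat \<Rightarrow> int list) \<Rightarrow> bool" where
  "knights_tour t \<longleftrightarrow> bij_betw t {1..256} cells \<and>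
     (\<forall>n\<in>{1..<256}. knight_move (t n) (t (n + 1)))"

definition cell_number :: "(nat \<Rightarrow> int list) \<Rightarrow> int list \<Rightarrow> nat" where
  "cell_number t = the_inv_into {1..256} t"

definition line :: "nat \<Rightarrow> int list \<Rightarrow> int list set" where
  "line i a = {c \<in> cells. \<forall>j<4. j \<noteq> i \<longrightarrow> c ! j = a ! j}"

definition lines :: "int list set set" where
  "lines = {line i a | i a. i < 4 \<and> a \<in> cells}"

definition magic_knights_tour :: "(nat \<Rightarrow> int list) \<Rightarrow> bool" where
  "magic_knights_tour t \<longleftrightarrow> knights_tour t \<and>
     (\<exists>s. \<forall>L\<in>lines. (\<Sum>c\<in>L. cell_number t c) = s)"

end

(* The theorem is proved by an explicit tour, found by computer search in a structured family.
   Write each coordinate x as x - 1 = 2 * h + l with bits h, l. Flipping h_i and l_j for i \<noteq> j is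
   always a knight's move, and the four commuting moves (h_1, l_2), (h_2, l_1), (h_3, l_4), (h_4, l_3)
   partition the 256 cells into 16 blocks, each carrying the graph of a 4-dimensional cube. The tour
   exhausts the blocks one after the other, along a Hamiltonian path of the cube in each block. The
   blocks form a 4 x 4 array such that every line of the hypercube meets exactly the four blocks of
   one row or column. Hence it suffices that the times at which the blocks are visited, counted from
   0 to 15, sum to 30 in every row and column, and that so do the positions of the four cells of a
   line within their blocks: 16 * 30 + 30 + 4 = 514. The search was also restricted to tours whose
   second half is the first one reflected in the first and third coordinates. *)

theory Submission
  imports Defs
begin

definition tour :: "int list list" where
  "tour = [
    [3,2,4,1], [3,2,3,3], [4,4,3,3], [4,4,4,1], [4,4,2,2], [4,4,1,4], [3,2,1,4], [3,2,2,2],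
    [1,1,2,2], [1,1,1,4], [2,3,1,4], [2,3,2,2], [2,3,4,1], [2,3,3,3], [1,1,3,3], [1,1,4,1],
    [1,2,2,1], [1,2,1,3], [2,4,1,3], [2,4,2,1], [2,4,4,2], [2,4,3,4], [1,2,3,4], [1,2,4,2],
    [3,1,4,2], [3,1,3,4], [4,3,3,4], [4,3,4,2], [4,3,2,1], [4,3,1,3], [3,1,1,3], [3,1,2,1],
    [2,1,4,1], [2,1,3,3], [1,3,3,3], [1,3,4,1], [1,3,2,2], [1,3,1,4], [2,1,1,4], [2,1,2,2],
    [4,2,2,2], [4,2,1,4], [3,4,1,4], [3,4,2,2], [3,4,4,1], [3,4,3,3], [4,2,3,3], [4,2,4,1],
    [4,1,2,1], [4,1,1,3], [3,3,1,3], [3,3,2,1], [3,3,4,2], [3,3,3,4], [4,1,3,4], [4,1,4,2],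
    [2,2,4,2], [2,2,3,4], [1,4,3,4], [1,4,4,2], [1,4,2,1], [1,4,1,3], [2,2,1,3], [2,2,2,1],
    [2,4,3,1], [2,4,4,3], [1,2,4,3], [1,2,3,1], [1,2,1,2], [1,2,2,4], [2,4,2,4], [2,4,1,2],
    [4,3,1,2], [4,3,2,4], [3,1,2,4], [3,1,1,2], [3,1,3,1], [3,1,4,3], [4,3,4,3], [4,3,3,1],
    [4,4,1,1], [4,4,2,3], [3,2,2,3], [3,2,1,1], [3,2,3,2], [3,2,4,4], [4,4,4,4], [4,4,3,2],
    [2,3,3,2], [2,3,4,4], [1,1,4,4], [1,1,3,2], [1,1,1,1], [1,1,2,3], [2,3,2,3], [2,3,1,1],
    [3,3,3,1], [3,3,4,3], [4,1,4,3], [4,1,3,1], [4,1,1,2], [4,1,2,4], [3,3,2,4], [3,3,1,2],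
    [1,4,1,2], [1,4,2,4], [2,2,2,4], [2,2,1,2], [2,2,3,1], [2,2,4,3], [1,4,4,3], [1,4,3,1],
    [1,3,1,1], [1,3,2,3], [2,1,2,3], [2,1,1,1], [2,1,3,2], [2,1,4,4], [1,3,4,4], [1,3,3,2],
    [3,4,3,2], [3,4,4,4], [4,2,4,4], [4,2,3,2], [4,2,1,1], [4,2,2,3], [3,4,2,3], [3,4,1,1],
    [2,2,1,1], [2,2,2,3], [1,4,2,3], [1,4,1,1], [1,4,3,2], [1,4,4,4], [2,2,4,4], [2,2,3,2],
    [4,1,3,2], [4,1,4,4], [3,3,4,4], [3,3,3,2], [3,3,1,1], [3,3,2,3], [4,1,2,3], [4,1,1,1],
    [4,2,3,1], [4,2,4,3], [3,4,4,3], [3,4,3,1], [3,4,1,2], [3,4,2,4], [4,2,2,4], [4,2,1,2],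
    [2,1,1,2], [2,1,2,4], [1,3,2,4], [1,3,1,2], [1,3,3,1], [1,3,4,3], [2,1,4,3], [2,1,3,1],
    [3,1,1,1], [3,1,2,3], [4,3,2,3], [4,3,1,1], [4,3,3,2], [4,3,4,4], [3,1,4,4], [3,1,3,2],
    [1,2,3,2], [1,2,4,4], [2,4,4,4], [2,4,3,2], [2,4,1,1], [2,4,2,3], [1,2,2,3], [1,2,1,1],
    [1,1,3,1], [1,1,4,3], [2,3,4,3], [2,3,3,1], [2,3,1,2], [2,3,2,4], [1,1,2,4], [1,1,1,2],
    [3,2,1,2], [3,2,2,4], [4,4,2,4], [4,4,1,2], [4,4,3,1], [4,4,4,3], [3,2,4,3], [3,2,3,1],
    [3,4,2,1], [3,4,1,3], [4,2,1,3], [4,2,2,1], [4,2,4,2], [4,2,3,4], [3,4,3,4], [3,4,4,2],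
    [1,3,4,2], [1,3,3,4], [2,1,3,4], [2,1,4,2], [2,1,2,1], [2,1,1,3], [1,3,1,3], [1,3,2,1],
    [1,4,4,1], [1,4,3,3], [2,2,3,3], [2,2,4,1], [2,2,2,2], [2,2,1,4], [1,4,1,4], [1,4,2,2],
    [3,3,2,2], [3,3,1,4], [4,1,1,4], [4,1,2,2], [4,1,4,1], [4,1,3,3], [3,3,3,3], [3,3,4,1],
    [2,3,2,1], [2,3,1,3], [1,1,1,3], [1,1,2,1], [1,1,4,2], [1,1,3,4], [2,3,3,4], [2,3,4,2],
    [4,4,4,2], [4,4,3,4], [3,2,3,4], [3,2,4,2], [3,2,2,1], [3,2,1,3], [4,4,1,3], [4,4,2,1],
    [4,3,4,1], [4,3,3,3], [3,1,3,3], [3,1,4,1], [3,1,2,2], [3,1,1,4], [4,3,1,4], [4,3,2,2],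
    [2,4,2,2], [2,4,1,4], [1,2,1,4], [1,2,2,2], [1,2,4,1], [1,2,3,3], [2,4,3,3], [2,4,4,1]]"

text \<open>The numbers of the cells: having the inverse of the tour as a second table makes injectivity and
  the line sums cheap to evaluate.\<close>

definition grid :: "int list list list list" where
  "grid = [
    [[[93,184,227,10], [228,9,94,183], [177,92,15,230], [16,229,178,91]],
     [[176,69,18,251], [17,252,175,70], [68,169,254,23], [253,24,67,170]],
     [[113,156,207,38], [208,37,114,155], [157,120,35,202], [36,201,158,119]],
     [[132,105,62,215], [61,216,131,106], [112,133,210,59], [209,60,111,134]]],
    [[[116,153,206,39], [205,40,115,154], [160,117,34,203], [33,204,159,118]],
     [[129,108,63,214], [64,213,130,107], [109,136,211,58], [212,57,110,135]],
     [[96,181,226,11], [225,12,95,182], [180,89,14,231], [13,232,179,90]],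
     [[173,72,19,250], [20,249,174,71], [65,172,255,22], [256,21,66,171]]],
    [[[161,76,31,246], [32,245,162,75], [77,168,243,26], [244,25,78,167]],
     [[84,185,238,7], [237,8,83,186], [192,85,2,235], [1,236,191,86]],
     [[141,104,51,218], [52,217,142,103], [97,140,223,54], [224,53,98,139]],
     [[128,149,194,43], [193,44,127,150], [148,121,46,199], [45,200,147,122]]],
    [[[144,101,50,219], [49,220,143,102], [100,137,222,55], [221,56,99,138]],
     [[125,152,195,42], [196,41,126,151], [145,124,47,198], [48,197,146,123]],
     [[164,73,30,247], [29,248,163,74], [80,165,242,27], [241,28,79,166]],
     [[81,188,239,6], [240,5,82,187], [189,88,3,234], [4,233,190,87]]]]"

definition grid_entry :: "int list \<Rightarrow> int" where
  "grid_entry c = grid ! nat (c ! 0 - 1) ! nat (c ! 1 - 1) ! nat (c ! 2 - 1) ! nat (c ! 3 - 1)"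

lemma all_less_4_iff: "(\<forall>j<4. P j) \<longleftrightarrow> list_all P [0, 1, 2, 3 :: nat]"
  by (auto simp: numeral_eq_Suc less_Suc_eq)

lemma ex_less_4_iff: "(\<exists>j<4. P j) \<longleftrightarrow> list_ex P [0, 1, 2, 3 :: nat]"
  using all_less_4_iff[of "\<lambda>j. \<not> P j"] by auto

text \<open>Executable form of the geometric condition in \<open>knight_move\<close>: quantifiers
  over list literals can be evaluated by \<open>code_simp\<close>. Membership in
  \<open>cells\<close> is left out, being checked once for the whole tour.\<close>

definition is_knight_move :: "int list \<Rightarrow> int list \<Rightarrow> bool" where
  "is_knight_move c d \<longleftrightarrow>
     list_ex (\<lambda>i. list_ex (\<lambda>j. i \<noteq> j \<and> \<bar>c ! i - d ! i\<bar> = 2 \<and> \<bar>c ! j - d ! j\<bar> = 1 \<and>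
       list_all (\<lambda>k. k \<noteq> i \<and> k \<noteq> j \<longrightarrow> c ! k = d ! k) [0, 1, 2, 3]) [0, 1, 2, 3]) [0, 1, 2, 3]"

lemma knight_move_iff:
  "knight_move c d \<longleftrightarrow> c \<in> cells \<and> d \<in> cells \<and> is_knight_move c d"
  unfolding knight_move_def is_knight_move_def all_less_4_iff
  by (simp only: ex_less_4_iff)

lemma cells_eq_n_lists: "cells = set (List.n_lists 4 [1, 2, 3, 4])"
proof -
  have "{1..4 :: int} = set [1, 2, 3, 4]"
    by auto
  then show ?thesis
    by (simp add: cells_def set_n_lists)
qed

lemma finite_cells: "finite cells"
  by (simp add: cells_eq_n_lists)

lemma card_cells: "card cells = 256"
  using card_lists_length_eq[of "{1..4 :: int}" 4] by (simp add: cells_def conj_commute)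

lemma set_tour_subset_cells: "set tour \<subseteq> cells"
proof -
  have "list_all (\<lambda>c. length c = 4 \<and> list_all (\<lambda>x. 1 \<le> x \<and> x \<le> 4) c) tour"
    by code_simp
  then show ?thesis
    by (auto simp: cells_def list_all_iff)
qed

text \<open>This one evaluation certifies that the table inverts the tour; distinctness and the cell
  numbers are both derived from it.\<close>

lemma map_grid_entry_tour: "map grid_entry tour = [1..256]"
  by code_simp

lemma tour_moves: "list_all (\<lambda>(c, d). is_knight_move c d) (zip tour (tl tour))"
  by code_simp

text \<open>Every cell serves as base point in every direction, so each line is tested four times;
  no choice of representatives is needed.\<close>

lemma grid_line_sums:
  "list_all (\<lambda>a. list_all (\<lambda>i. (\<Sum>k\<leftarrow>[1, 2, 3, 4]. grid_entry (a[i := k])) = 514) [0, 1, 2, 3])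
     (List.n_lists 4 [1, 2, 3, 4])"
  by code_simp

lemma length_tour: "length tour = 256"
  by (simp add: tour_def)

lemma distinct_tour: "distinct tour"
proof -
  \<comment> \<open>A list whose image under some function is distinct is itself distinct, which
    avoids comparing all pairs of cells.\<close>
  have "distinct (map grid_entry tour)"
    unfolding map_grid_entry_tour by (rule distinct_upto)
  then show ?thesis
    by (simp only: distinct_map)
qed

lemma grid_entry_tour_nth:
  assumes "k < 256"
  shows "grid_entry (tour ! k) = int k + 1"
proof -
  have "grid_entry (tour ! k) = map grid_entry tour ! k"
    using assms by (simp add: length_tour)
  also have "\<dots> = 1 + int k"
    unfolding map_grid_entry_tour using assms by (intro nth_upto) simp
  finally show ?thesis
    by simp
qed

lemma bij_betw_tour: "bij_betw (\<lambda>n. tour ! (n - 1)) {1..256} cells"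
proof -
  have "bij_betw (\<lambda>n. n - 1) {1..256::nat} {..<256}"
    by (rule bij_betw_byWitness[where f' = Suc]) auto
  moreover have "bij_betw ((!) tour) {..<256} (set tour)"
    by (rule bij_betw_nth[OF distinct_tour]) (simp_all add: length_tour)
  moreover have "set tour = cells"
    \<comment> \<open>Surjectivity by counting: 256 distinct cells among 256.\<close>
    using set_tour_subset_cells finite_cells distinct_tour
    by (intro card_subset_eq) (simp_all add: distinct_card length_tour card_cells)
  ultimately show ?thesis
    using bij_betw_trans[of "\<lambda>n. n - 1" "{1..256}" "{..<256}" "(!) tour" cells]
    by (simp add: comp_def)
qed

lemma knights_tour_tour: "knights_tour (\<lambda>n. tour ! (n - 1))"
  unfolding knights_tour_def
proof (intro conjI ballI)
  fix n :: nat
  assume "n \<in> {1..<256}"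
  \<comment> \<open>Steps are numbered from 1, list positions from 0; \<open>k\<close> is the
    position of step \<open>n\<close>.\<close>
  then obtain k where k: "n = Suc k" "Suc k < 256"
    by (cases n) auto
  have "is_knight_move (tour ! k) (tour ! Suc k)"
    using tour_moves k(2) by (auto simp: list_all_length length_tour nth_tl)
  moreover have "tour ! k \<in> cells" "tour ! Suc k \<in> cells"
    using set_tour_subset_cells k(2) by (auto simp: length_tour)
  ultimately show "knight_move (tour ! (n - 1)) (tour ! (n + 1 - 1))"
    by (simp add: knight_move_iff k(1))
qed (rule bij_betw_tour)

text \<open>Replaces the abstract inverse in \<open>cell_number\<close> by a table lookup, so that
  line sums become computable.\<close>

lemma cell_number_tour:
  assumes "c \<in> cells"
  shows "int (cell_number (\<lambda>n. tour ! (n - 1)) c) = grid_entry c"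
proof -
  let ?t = "\<lambda>n. tour ! (n - 1)"
  obtain n where n: "n \<in> {1..256}" "c = ?t n"
    using bij_betw_tour assms unfolding bij_betw_def by blast
  have "cell_number ?t c = n"
    unfolding cell_number_def n(2)
    using bij_betw_imp_inj_on[OF bij_betw_tour] n(1) by (rule the_inv_into_f_f)
  moreover have "grid_entry c = int n"
    using n grid_entry_tour_nth[of "n - 1"] by auto
  ultimately show ?thesis
    by simp
qed

text \<open>\<open>line i a\<close> ignores coordinate \<open>i\<close> of \<open>a\<close>, so
  overwriting that coordinate sweeps out the whole line.\<close>

lemma line_eq_image:
  assumes "i < 4" "a \<in> cells"
  shows "line i a = (\<lambda>k. a[i := k]) ` {1..4}"
proof (intro set_eqI iffI)
  fix c
  assume "c \<in> line i a"
  then have c: "length c = 4" "set c \<subseteq> {1..4}" and eq: "\<And>j. j < 4 \<Longrightarrow> j \<noteq> i \<Longrightarrow> c ! j = a ! j"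
    by (auto simp: line_def cells_def)
  have "c = a[i := c ! i]"
    using assms c eq by (auto simp: cells_def nth_list_update intro!: nth_equalityI)
  moreover have "c ! i \<in> {1..4}"
    using assms(1) c by (metis nth_mem subsetD)
  ultimately show "c \<in> (\<lambda>k. a[i := k]) ` {1..4}"
    by blast
next
  fix c
  assume "c \<in> (\<lambda>k. a[i := k]) ` {1..4}"
  then show "c \<in> line i a"
    using assms set_update_subset_insert[of a i] by (fastforce simp: line_def cells_def)
qed

lemma sum_line:
  assumes "i < 4" "a \<in> cells"
  shows "(\<Sum>c\<in>line i a. f c) = (\<Sum>k\<leftarrow>[1, 2, 3, 4]. f (a[i := k]))"
proof -
  have "inj_on (\<lambda>k. a[i := k]) {1..4}"
    \<comment> \<open>Reading off coordinate \<open>i\<close> recovers \<open>k\<close>.\<close>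
    using assms by (intro inj_onI) (metis (mono_tags) cells_def mem_Collect_eq nth_list_update_eq)
  then have "(\<Sum>c\<in>line i a. f c) = (\<Sum>k\<in>{1..4}. f (a[i := k]))"
    by (simp add: line_eq_image[OF assms] sum.reindex)
  also have "{1..4 :: int} = set [1, 2, 3, 4]"
    by auto
  finally show ?thesis
    by (simp add: add.assoc)
qed

theorem mainTheorem3:
  "\<exists>t. magic_knights_tour t \<and> (\<forall>L\<in>lines. (\<Sum>c\<in>L. cell_number t c) = 514)"
proof -
  let ?t = "\<lambda>n. tour ! (n - 1)"
  have "(\<Sum>c\<in>L. cell_number ?t c) = 514" if L_in: "L \<in> lines" for L
  proof -
    obtain i a where L: "L = line i a" and i: "i < 4" and a: "a \<in> cells"
      using L_in unfolding lines_def by blast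
    \<comment> \<open>The table holds integers while cell numbers are naturals, so the sum is
      computed in the integers and cast back at the end.\<close>
    have "int (\<Sum>c\<in>L. cell_number ?t c) = (\<Sum>c\<in>L. grid_entry c)"
      unfolding of_nat_sum
      by (rule sum.cong[OF refl cell_number_tour]) (simp add: L line_def)
    also have "\<dots> = (\<Sum>k\<leftarrow>[1, 2, 3, 4]. grid_entry (a[i := k]))"
      unfolding L by (rule sum_line[OF i a])
    also have "\<dots> = 514"
    proof -
      have "i \<in> set [0, 1, 2, 3]"
        using i by (auto simp: numeral_eq_Suc less_Suc_eq)
      then show ?thesis
        using grid_line_sums a unfolding list_all_iff cells_eq_n_lists by blast
    qed
    finally show ?thesis
      by (metis of_nat_eq_iff of_nat_numeral)
  qed
  then show ?thesis
    using knights_tour_tour unfolding magic_knights_tour_def by blast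
qed

end
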